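(* Let $X$ be a geodesic space and $A$ a subset of $X$ of infinite diameter. Then $A$ is Morse in $X$ if and only if the lower relative divergence of $X$ with respect to $A$ is completely super linear.
   Context: A $(K,L)$-quasi-geodesic is a map $c$ from an interval of $\mathbb{R}$ to a metric space with $\frac1K|s-t|-L\le d(c(s),c(t))\le K|s-t|+L$. A subset $A$ of a geodesic space $X$ is Morse if for every $K\ge1$, $C\ge0$ there is $M=M(K,C)$ such that every $(K,C)$-quasi-geodesic with endpoints on $A$ lies in the $M$-neighborhood of $A$. Lower relative divergence: put $N_r(A)=\{x: d(x,A)<r\}$, $\partial N_r(A)=\{x: d(x,A)=r\}$, $C_r(A)=X-N_r(A)$, and let $d_r$ be the induced length metric on $C_r(A)$ (value $\infty$ if there is no connecting rectifiable path). For $\rho\in(0,1]$ and integer $n\ge2$ define $\sigma^n_\rho(r)\in[0,\infty]$ for $r>0$ by $\sigma^n_\rho(r)=\inf d_{\rho r}(x_1,x_2)$ over all $x_1,x_2\in\partial N_r(A)$ with $d_r(x_1,x_2)<\infty$ and $d(x_1,x_2)\ge nr$, and $\sigma^n_\rho(r)=\infty$ if no such pair exists. The family $\{\sigma^n_\rho\}$ is the lower relative divergence of $X$ with respect to $A$. A function $f:[0,\infty)\to[0,\infty]$ is completely super linear if for every $C>0$ the set $\{x: f(x)\le Cx\}$ is bounded. A family $\{\delta^n_\rho\}$ ($\rho\in(0,1]$, $n\ge2$) is completely super linear if there is $n_0\ge3$ such that $\delta^{n_0}_\rho$ is completely super linear for all $\rho\in(0,1]$. *)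

theory Defs
  imports "HOL-Analysis.Analysis"
begin

text \<open>The geodesic space is a whole type of class \<^class>\<open>metric_space\<close>.\<close>

definition geodesic_space :: "'a::metric_space itself \<Rightarrow> bool" where
  "geodesic_space (_ :: 'a itself) \<longleftrightarrow>
     (\<forall>x y :: 'a. \<exists>g :: real \<Rightarrow> 'a. g 0 = x \<and> g (dist x y) = y \<and>
        (\<forall>s \<in> {0..dist x y}. \<forall>t \<in> {0..dist x y}. dist (g s) (g t) = \<bar>s - t\<bar>))"

text \<open>Quasi-geodesics need not be continuous; only the values of \<open>c\<close> on \<open>I\<close> matter.\<close>

definition quasi_geodesic :: "real \<Rightarrow> real \<Rightarrow> real set \<Rightarrow> (real \<Rightarrow> 'a::metric_space) \<Rightarrow> bool" where
  "quasi_geodesic K L I c \<longleftrightarrow> is_interval I \<and>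
     (\<forall>s \<in> I. \<forall>t \<in> I. 1 / K * \<bar>s - t\<bar> - L \<le> dist (c s) (c t) \<and>
                      dist (c s) (c t) \<le> K * \<bar>s - t\<bar> + L)"

text \<open>\<^const>\<open>infdist\<close> has the junk value 0 for the empty set, so the next three definitions
  have their intended meaning only for nonempty \<open>A\<close>.\<close>

definition nbhd :: "real \<Rightarrow> 'a::metric_space set \<Rightarrow> 'a set" where
  "nbhd r A = {x. infdist x A < r}"

definition nbhd_boundary :: "real \<Rightarrow> 'a::metric_space set \<Rightarrow> 'a set" where
  "nbhd_boundary r A = {x. infdist x A = r}"

definition nbhd_compl :: "real \<Rightarrow> 'a::metric_space set \<Rightarrow> 'a set" where
  "nbhd_compl r A = UNIV - nbhd r A"

definition Morse :: "'a::metric_space set \<Rightarrow> bool" where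
  "Morse A \<longleftrightarrow>
     (\<forall>K \<ge> 1. \<forall>C \<ge> 0. \<exists>M. \<forall>a b c. a \<le> b \<and> quasi_geodesic K C {a..b} c \<and> c a \<in> A \<and> c b \<in> A
        \<longrightarrow> c ` {a..b} \<subseteq> nbhd M A)"

text \<open>The list \<open>ts\<close> ranges over the finite partitions; the value is \<open>\<infinity>\<close> iff \<open>g\<close> is not rectifiable.\<close>

definition path_length :: "(real \<Rightarrow> 'a::metric_space) \<Rightarrow> ennreal" where
  "path_length g =
     (SUP ts \<in> {ts. sorted ts \<and> set ts \<subseteq> {0..1}}.
        \<Sum>i < length ts - 1. ennreal (dist (g (ts ! i)) (g (ts ! Suc i))))"

text \<open>The infimum of the empty set in \<^typ>\<open>ennreal\<close> is \<open>\<infinity>\<close>. Hence \<open>length_dist S x y = \<infinity>\<close> iff no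
  rectifiable path in \<open>S\<close> joins \<open>x\<close> and \<open>y\<close>, and below \<open>lower_rel_div A \<rho> n r = \<infinity>\<close> if there is no
  admissible pair of points.\<close>

definition length_dist :: "'a::metric_space set \<Rightarrow> 'a \<Rightarrow> 'a \<Rightarrow> ennreal" where
  "length_dist S x y =
     Inf {path_length g | g. path g \<and> path_image g \<subseteq> S \<and> pathstart g = x \<and> pathfinish g = y}"

definition lower_rel_div :: "'a::metric_space set \<Rightarrow> real \<Rightarrow> nat \<Rightarrow> real \<Rightarrow> ennreal" where
  "lower_rel_div A \<rho> n r =
     Inf {length_dist (nbhd_compl (\<rho> * r) A) x1 x2 | x1 x2.
            x1 \<in> nbhd_boundary r A \<and> x2 \<in> nbhd_boundary r A \<and>
            length_dist (nbhd_compl r A) x1 x2 < \<infinity> \<and> real n * r \<le> dist x1 x2}"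

text \<open>Functions on \<open>[0, \<infinity>)\<close> are functions on \<^typ>\<open>real\<close> whose values at negative arguments are
  ignored. The value at the single point 0 is irrelevant for complete super linearity.\<close>

definition completely_super_linear :: "(real \<Rightarrow> ennreal) \<Rightarrow> bool" where
  "completely_super_linear f \<longleftrightarrow> (\<forall>C > 0. bounded {x. 0 \<le> x \<and> f x \<le> ennreal (C * x)})"

definition completely_super_linear_family :: "(real \<Rightarrow> nat \<Rightarrow> real \<Rightarrow> ennreal) \<Rightarrow> bool" where
  "completely_super_linear_family \<delta> \<longleftrightarrow>
     (\<exists>n0 \<ge> 3. \<forall>\<rho>. 0 < \<rho> \<and> \<rho> \<le> 1 \<longrightarrow> completely_super_linear (\<delta> \<rho> n0))"

end

theory Submission
  imports Defs
begin

text \<open>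
  From Morse to super linear. Suppose that for arbitrarily large \<open>r\<close> two points of
  \<open>nbhd_boundary r A\<close> at distance at least \<open>3 * r\<close> are joined outside \<open>nbhd (\<rho> * r) A\<close> by
  a path of length about \<open>C * r\<close>. Their near-projections \<open>a1\<close>, \<open>a2\<close> to \<open>A\<close> are still
  \<open>r - 2\<close> apart. Make travelling inside a fixed neighbourhood \<open>nbhd M A\<close> more expensive by a
  factor \<open>\<Lambda>\<close>, and join \<open>a1\<close> to \<open>a2\<close> as cheaply as possible. The cost is a length for a metric
  that lies between the given one and its \<open>\<Lambda>\<close>-fold, so a cheapest connection is a
  quasi-geodesic with constants that depend on \<open>\<Lambda>\<close> only
  (\<open>minimal_chain_quasi_geodesic\<close>). The Morse property, applied to these constants, yields
  the \<open>M\<close> that is used to define the cost. The cheapest connection then stays in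
  \<open>nbhd M A\<close> and costs at least \<open>\<Lambda> * (r - 2)\<close>. But going out to the given path, along it and
  back costs \<open>(C + 3) * r\<close> plus a constant, because only a bounded part of it is expensive. With
  \<open>\<Lambda> \<ge> C + 4\<close> this bounds \<open>r\<close>. There is no circularity, as \<open>\<Lambda>\<close> is chosen from \<open>C\<close> alone.
  Chains of points with steps of length at most 1 and natural number weights replace weighted
  paths, so that a cheapest one exists.

  From super linear to Morse. Take \<open>\<rho> = 1\<close>. On a quasi-geodesic with endpoints in \<open>A\<close>
  choose a parameter \<open>t\<close> at which the distance to \<open>A\<close> is large and at least half of its
  supremum, and let \<open>r\<close> be this distance divided by a constant \<open>N\<close>. Follow the quasi-geodesic
  from \<open>t\<close> in both directions until its distance to \<open>A\<close> drops to a small multiple of \<open>r\<close>. If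
  this happens within a time comparable to \<open>r\<close> on both sides, take the whole excursion: it
  starts and ends near \<open>A\<close>, and a large \<open>N\<close> forces it to be long. Otherwise cut a piece of
  length comparable to \<open>r\<close> out of the long side; near-maximality at \<open>t\<close> bounds the height of
  its ends by \<open>2 * N * r\<close>. In both cases, descending from the two ends to
  \<open>nbhd_boundary r A\<close> gives an admissible pair of points joined by a path of length at most a
  constant times \<open>r\<close> (\<open>lower_rel_div_le_of_excursion\<close>), which is impossible for large \<open>r\<close>.
\<close>

section \<open>Weighted chains and quasi-geodesics\<close>

text \<open>A chain pays the weight of every point except its first one. This makes costs additive
  under concatenation.\<close>

inductive unit_chain :: "('a::metric_space \<Rightarrow> nat) \<Rightarrow> 'a \<Rightarrow> 'a \<Rightarrow> nat \<Rightarrow> bool" for w where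
  refl: "unit_chain w x x 0"
| step: "unit_chain w x y k \<Longrightarrow> dist y z \<le> 1 \<Longrightarrow> unit_chain w x z (k + w z)"

lemma unit_chain_trans:
  assumes "unit_chain w y z l" "unit_chain w x y k"
  shows "unit_chain w x z (k + l)"
  using assms by (induction rule: unit_chain.induct) (auto simp: add.assoc[symmetric] intro: unit_chain.step)

lemma unit_chain_of_sequence:
  assumes "i \<le> j" and "\<And>p. i \<le> p \<Longrightarrow> p < j \<Longrightarrow> dist (x p) (x (Suc p)) \<le> 1"
  shows "unit_chain w (x i) (x j) (\<Sum>p=i..<j. w (x (Suc p)))"
  using assms
proof (induction j rule: dec_induct)
  case base
  then show ?case by (simp add: unit_chain.refl)
next
  case (step j)
  then have "unit_chain w (x i) (x (Suc j)) ((\<Sum>p=i..<j. w (x (Suc p))) + w (x (Suc j)))"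
    by (intro unit_chain.step) auto
  then show ?case using step by simp
qed

lemma sequence_of_unit_chain:
  assumes "unit_chain w u v k"
  obtains x m where "x 0 = u" "x m = v" "\<And>p. p < m \<Longrightarrow> dist (x p) (x (Suc p)) \<le> 1"
    "(\<Sum>p<m. w (x (Suc p))) = k"
proof -
  from assms have "\<exists>x m. x 0 = u \<and> x m = v \<and> (\<forall>p<m. dist (x p) (x (Suc p)) \<le> 1) \<and>
      (\<Sum>p<m. w (x (Suc p))) = k"
  proof (induction rule: unit_chain.induct)
    case (refl x)
    show ?case by (rule exI[of _ "\<lambda>_. x"], rule exI[of _ 0]) simp
  next
    case (step u y k z)
    then obtain x m where x: "x 0 = u" "x m = y" "\<forall>p<m. dist (x p) (x (Suc p)) \<le> 1"
      "(\<Sum>p<m. w (x (Suc p))) = k" by blast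
    have "(\<Sum>p<m. w ((x(Suc m := z)) (Suc p))) = k"
      unfolding x(4)[symmetric] by (intro sum.cong) auto
    then show ?case using x step.hyps
      by (intro exI[of _ "x(Suc m := z)"] exI[of _ "Suc m"]) (auto simp: less_Suc_eq)
  qed
  then show ?thesis using that by blast
qed

text \<open>A cost bound that also serves pieces of geodesics on which the weight is constantly 1.\<close>

lemma unit_chain_lipschitz:
  fixes h :: "real \<Rightarrow> 'a::metric_space"
  assumes "1-lipschitz_on {\<alpha>..\<beta>} h" "\<alpha> \<le> \<beta>" "\<And>t. t \<in> {\<alpha>..\<beta>} \<Longrightarrow> w (h t) \<le> W"
  shows "\<exists>k. unit_chain w (h \<alpha>) (h \<beta>) k \<and> real k \<le> real W * (\<beta> - \<alpha> + 1)"
proof -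
  have *: "\<exists>k. unit_chain w (h \<alpha>) (h \<beta>) k \<and> k \<le> W * n"
    if "1-lipschitz_on {\<alpha>..\<beta>} h" "\<alpha> \<le> \<beta>" "\<And>t. t \<in> {\<alpha>..\<beta>} \<Longrightarrow> w (h t) \<le> W" "\<beta> - \<alpha> \<le> real n"
    for n \<beta>
    using that
  proof (induction n arbitrary: \<beta>)
    case 0
    then have "\<alpha> = \<beta>" by simp
    then show ?case by (auto intro: unit_chain.refl)
  next
    case (Suc n)
    define \<gamma> where "\<gamma> = max \<alpha> (\<beta> - 1)"
    have \<gamma>: "\<alpha> \<le> \<gamma>" "\<gamma> \<le> \<beta>" "\<beta> - \<gamma> \<le> 1" "\<gamma> - \<alpha> \<le> real n"
      using Suc.prems by (auto simp: \<gamma>_def)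
    have "\<exists>k. unit_chain w (h \<alpha>) (h \<gamma>) k \<and> k \<le> W * n"
      using Suc.prems \<gamma> by (intro Suc.IH) (auto intro: lipschitz_on_subset)
    then obtain k where k: "unit_chain w (h \<alpha>) (h \<gamma>) k" "k \<le> W * n" by blast
    have "dist (h \<gamma>) (h \<beta>) \<le> 1"
      using lipschitz_onD[OF Suc.prems(1), of \<gamma> \<beta>] \<gamma> by (auto simp: dist_real_def)
    then have "unit_chain w (h \<alpha>) (h \<beta>) (k + w (h \<beta>))"
      by (rule unit_chain.step[OF k(1)])
    moreover have "k + w (h \<beta>) \<le> W * Suc n"
      using k(2) Suc.prems(3)[of \<beta>] Suc.prems(2) by simp
    ultimately show ?case by blast
  qed
  have "\<beta> - \<alpha> \<le> real (nat \<lceil>\<beta> - \<alpha>\<rceil>)" by linarith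
  from *[OF assms(1,2,3) this] obtain k where
    k: "unit_chain w (h \<alpha>) (h \<beta>) k" "k \<le> W * nat \<lceil>\<beta> - \<alpha>\<rceil>" by auto
  have "real k \<le> real W * real (nat \<lceil>\<beta> - \<alpha>\<rceil>)"
    using k(2) by (metis of_nat_le_iff of_nat_mult)
  also have "\<dots> \<le> real W * (\<beta> - \<alpha> + 1)"
    using assms(2) by (intro mult_left_mono) linarith+
  finally show ?thesis using k(1) by blast
qed

lemma lipschitz_on_reverse:
  fixes h :: "real \<Rightarrow> 'a::metric_space"
  assumes "C-lipschitz_on {\<alpha>..\<beta>} h"
  shows "C-lipschitz_on {\<sigma> - \<beta>..\<sigma> - \<alpha>} (\<lambda>t. h (\<sigma> - t))"
proof (rule lipschitz_onI)
  fix s t assume "s \<in> {\<sigma> - \<beta>..\<sigma> - \<alpha>}" "t \<in> {\<sigma> - \<beta>..\<sigma> - \<alpha>}"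
  then show "dist (h (\<sigma> - s)) (h (\<sigma> - t)) \<le> C * dist s t"
    using lipschitz_onD[OF assms, of "\<sigma> - s" "\<sigma> - t"]
    by (auto simp: dist_real_def abs_minus_commute)
qed (use assms lipschitz_on_nonneg in blast)

lemma geodesic_obtain:
  fixes x y :: "'a::metric_space"
  assumes "geodesic_space TYPE('a)"
  obtains h where "h 0 = x" "h (dist x y) = y" "1-lipschitz_on {0..dist x y} h"
    "\<And>s. s \<in> {0..dist x y} \<Longrightarrow> dist x (h s) = s"
    "\<And>s. s \<in> {0..dist x y} \<Longrightarrow> dist (h s) y = dist x y - s"
proof -
  obtain h where h: "h 0 = x" "h (dist x y) = y"
    "\<forall>s \<in> {0..dist x y}. \<forall>t \<in> {0..dist x y}. dist (h s) (h t) = \<bar>s - t\<bar>"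
    using assms unfolding geodesic_space_def by blast
  show ?thesis
  proof (rule that[OF h(1,2)])
    show "1-lipschitz_on {0..dist x y} h"
      by (rule lipschitz_onI) (use h(3) in \<open>auto simp: dist_real_def\<close>)
    show "dist x (h s) = s" if "s \<in> {0..dist x y}" for s
      using that h(3)[rule_format, of 0 s] h(1) by simp
    show "dist (h s) y = dist x y - s" if "s \<in> {0..dist x y}" for s
      using that h(3)[rule_format, of s "dist x y"] h(2) by simp
  qed
qed

text \<open>Every segment of a cheapest chain is itself cheapest. It costs at least its number of
  steps, and a chain along a geodesic between its ends costs at most \<open>\<Lambda>\<close> times their distance plus
  \<open>\<Lambda>\<close>. Hence the number of steps is controlled by the distance. The additive constant 2 also
  absorbs the rounding of the parameters.\<close>

lemma minimal_chain_quasi_geodesic: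
  fixes x :: "nat \<Rightarrow> 'a::metric_space"
  assumes geo: "geodesic_space TYPE('a)"
    and w: "\<And>z. 1 \<le> w z" "\<And>z. w z \<le> \<Lambda>"
    and steps: "\<And>p. p < m \<Longrightarrow> dist (x p) (x (Suc p)) \<le> 1"
    and minimal: "\<And>k. unit_chain w (x 0) (x m) k \<Longrightarrow> (\<Sum>p<m. w (x (Suc p))) \<le> k"
  shows "quasi_geodesic \<Lambda> 2 {0..real m} (\<lambda>t. x (nat \<lfloor>t\<rfloor>))"
proof -
  have \<Lambda>: "1 \<le> \<Lambda>" using w le_trans by blast
  have upper: "dist (x i) (x j) \<le> real (j - i)" if "i \<le> j" "j \<le> m" for i j
    using that
  proof (induction j rule: dec_induct)
    case (step j)
    have "dist (x i) (x (Suc j)) \<le> dist (x i) (x j) + dist (x j) (x (Suc j))"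
      by (rule dist_triangle)
    also have "\<dots> \<le> real (j - i) + 1" using step steps by (intro add_mono) auto
    finally show ?case using step.hyps by (simp add: of_nat_diff)
  qed simp
  have lower: "real (j - i) \<le> real \<Lambda> * (dist (x i) (x j) + 1)" if ij: "i \<le> j" "j \<le> m" for i j
  proof -
    obtain h where h: "h 0 = x i" "h (dist (x i) (x j)) = x j" "1-lipschitz_on {0..dist (x i) (x j)} h"
      using geodesic_obtain[OF geo] by metis
    obtain k where k: "unit_chain w (x i) (x j) k" "real k \<le> real \<Lambda> * (dist (x i) (x j) + 1)"
      using unit_chain_lipschitz[OF h(3), of w \<Lambda>] w h(1,2) by auto
    \<comment> \<open>Replace the part of the chain between \<open>i\<close> and \<open>j\<close> by the chain along the geodesic.\<close>
    define S where "S a b = (\<Sum>p=a..<b. w (x (Suc p)))" for a b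
    have seg: "unit_chain w (x a) (x b) (S a b)" if "a \<le> b" "b \<le> m" for a b
      unfolding S_def using that steps by (intro unit_chain_of_sequence) auto
    have "unit_chain w (x 0) (x m) (S 0 i + k + S j m)"
      using ij by (intro unit_chain_trans[OF seg unit_chain_trans[OF k(1) seg]]) auto
    from minimal[OF this] have "S 0 m \<le> S 0 i + k + S j m"
      by (simp add: S_def atLeast0LessThan)
    moreover have "S 0 m = S 0 i + S i j + S j m"
      unfolding S_def using ij by (simp add: sum.atLeastLessThan_concat)
    ultimately have "S i j \<le> k" by simp
    moreover have "j - i \<le> S i j"
    proof -
      have "j - i = (\<Sum>p=i..<j. 1)" by simp
      also have "\<dots> \<le> S i j" unfolding S_def by (intro sum_mono w)
      finally show ?thesis .
    qed
    ultimately show ?thesis using k(2) by linarith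
  qed
  have *: "1 / real \<Lambda> * (t - s) - 2 \<le> dist (x (nat \<lfloor>s\<rfloor>)) (x (nat \<lfloor>t\<rfloor>)) \<and>
           dist (x (nat \<lfloor>s\<rfloor>)) (x (nat \<lfloor>t\<rfloor>)) \<le> real \<Lambda> * (t - s) + 2"
    if "0 \<le> s" "s \<le> t" "t \<le> real m" for s t
  proof -
    define i j where ij_def: "i = nat \<lfloor>s\<rfloor>" "j = nat \<lfloor>t\<rfloor>"
    have ij: "i \<le> j" "j \<le> m" unfolding ij_def using that by linarith+
    have diff: "real (j - i) \<le> t - s + 1" "t - s - 1 \<le> real (j - i)"
      unfolding of_nat_diff[OF ij(1)] unfolding ij_def using that by linarith+
    have "t - s \<le> real \<Lambda> * (t - s)" using \<Lambda> that by (simp add: mult_le_cancel_right1)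
    then have 1: "dist (x i) (x j) \<le> real \<Lambda> * (t - s) + 2"
      using upper[OF ij] diff by linarith
    have "t - s \<le> real \<Lambda> * (dist (x i) (x j) + 1) + 1"
      using lower[OF ij] diff by linarith
    also have "\<dots> \<le> real \<Lambda> * (dist (x i) (x j) + 2)" using \<Lambda> by (simp add: algebra_simps)
    finally have "(t - s) / real \<Lambda> \<le> dist (x i) (x j) + 2"
      using \<Lambda> by (simp add: divide_le_eq mult.commute)
    then show ?thesis using 1 unfolding ij_def by (simp add: field_simps)
  qed
  show ?thesis
    unfolding quasi_geodesic_def
  proof (intro conjI ballI)
    fix s t assume st: "s \<in> {0..real m}" "t \<in> {0..real m}"
    show "1 / real \<Lambda> * \<bar>s - t\<bar> - 2 \<le> dist (x (nat \<lfloor>s\<rfloor>)) (x (nat \<lfloor>t\<rfloor>))"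
      using *[of s t] *[of t s] st by (cases "s \<le> t") (auto simp: dist_commute abs_if)
    show "dist (x (nat \<lfloor>s\<rfloor>)) (x (nat \<lfloor>t\<rfloor>)) \<le> real \<Lambda> * \<bar>s - t\<bar> + 2"
      using *[of s t] *[of t s] st by (cases "s \<le> t") (auto simp: dist_commute abs_if)
  qed (simp add: is_interval_cc)
qed

text \<open>Mark points along the path whose consecutive distances are exactly 1. Their number is
  at most the length of the path, so a longest such list exists. By the intermediate value theorem
  its last point is within 1 of the end of the path, which is reached in one more step.\<close>

lemma unit_chain_path:
  fixes g :: "real \<Rightarrow> 'a::metric_space"
  assumes g: "path g" and len: "path_length g \<le> ennreal L" and "0 \<le> L"
    and light: "\<And>t. t \<in> {0..1} \<Longrightarrow> w (g t) = 1"
  shows "\<exists>k. unit_chain w (g 0) (g 1) k \<and> real k \<le> L + 1"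
proof -
  define P where "P n ts \<longleftrightarrow> length ts = Suc n \<and> ts ! 0 = 0 \<and> sorted ts \<and> set ts \<subseteq> {0..1} \<and>
      (\<forall>i<n. dist (g (ts ! i)) (g (ts ! Suc i)) = 1)" for n and ts :: "real list"
  have bound: "real n \<le> L" if "P n ts" for n ts
  proof -
    have "ennreal (real n) = (\<Sum>i < length ts - 1. ennreal (dist (g (ts ! i)) (g (ts ! Suc i))))"
      using that by (simp add: P_def ennreal_of_nat_eq_real_of_nat)
    also have "\<dots> \<le> path_length g"
      unfolding path_length_def using that by (intro SUP_upper) (auto simp: P_def)
    also have "\<dots> \<le> ennreal L" by (rule len)
    finally show ?thesis using \<open>0 \<le> L\<close> by simp
  qed
  have ex0: "\<exists>ts. P 0 ts" by (intro exI[of _ "[0]"]) (simp add: P_def)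
  have bdd: "\<forall>n. (\<exists>ts. P n ts) \<longrightarrow> n \<le> nat \<lfloor>L\<rfloor>"
    using bound by (auto simp: le_nat_floor)
  obtain n where n: "\<exists>ts. P n ts" and max: "\<And>n'. \<exists>ts. P n' ts \<Longrightarrow> n' \<le> n"
    using ex_has_greatest_nat[of "\<lambda>n. \<exists>ts. P n ts" 0 "\<lambda>n. n" "Suc (nat \<lfloor>L\<rfloor>)"] ex0 bdd
    by (metis le_imp_less_Suc)
  from n obtain ts where ts: "P n ts" by blast
  define \<tau> where "\<tau> = ts ! n"
  have "\<tau> \<in> set ts" using ts by (simp add: P_def \<tau>_def)
  then have \<tau>: "\<tau> \<in> {0..1}" using ts by (auto simp: P_def)
  have close: "dist (g \<tau>) (g 1) \<le> 1"
  proof (rule ccontr)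
    assume far: "\<not> ?thesis"
    have "continuous_on {\<tau>..1} g"
      using g \<tau> unfolding path_def by (auto intro: continuous_on_subset)
    then have "continuous_on {\<tau>..1} (\<lambda>s. dist (g \<tau>) (g s))" by (intro continuous_intros)
    then obtain s where s: "\<tau> \<le> s" "s \<le> 1" "dist (g \<tau>) (g s) = 1"
      using IVT'[of "\<lambda>s. dist (g \<tau>) (g s)" \<tau> 1 1] far \<tau> by force
    have "\<forall>y\<in>set ts. y \<le> s"
    proof
      fix y assume "y \<in> set ts"
      then obtain i where i: "i < length ts" "y = ts ! i" by (auto simp: in_set_conv_nth)
      then have "y \<le> ts ! n" using ts sorted_nth_mono[of ts i n] by (auto simp: P_def)
      then show "y \<le> s" using s by (simp add: \<tau>_def)
    qed
    then have "P (Suc n) (ts @ [s])"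
      using ts s order_trans[of 0 \<tau> s] \<tau> by (auto simp: P_def sorted_append nth_append \<tau>_def less_Suc_eq)
    then show False using max[of "Suc n"] by auto
  qed
  have "unit_chain w (g (ts ! 0)) (g (ts ! n)) (\<Sum>p=0..<n. w (g (ts ! Suc p)))"
    using ts by (intro unit_chain_of_sequence[of 0 n "\<lambda>p. g (ts ! p)"]) (auto simp: P_def)
  then have "unit_chain w (g (ts ! 0)) (g 1) ((\<Sum>p=0..<n. w (g (ts ! Suc p))) + w (g 1))"
    by (rule unit_chain.step) (use close in \<open>simp add: \<tau>_def\<close>)
  moreover have "(\<Sum>p=0..<n. w (g (ts ! Suc p))) = (\<Sum>p=0..<n. 1)"
  proof (rule sum.cong)
    fix p assume "p \<in> {0..<n}"
    then have "ts ! Suc p \<in> set ts" using ts by (auto simp: P_def)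
    then show "w (g (ts ! Suc p)) = 1" using ts light by (auto simp: P_def)
  qed simp
  ultimately have "unit_chain w (g 0) (g 1) (n + 1)"
    using ts light[of 1] by (simp add: P_def)
  then show ?thesis using bound[OF ts] by (intro exI[of _ "n + 1"]) simp
qed

section \<open>Morse subsets have completely super linear divergence\<close>

lemma in_nbhd_compl_iff: "x \<in> nbhd_compl r A \<longleftrightarrow> r \<le> infdist x A"
  by (auto simp: nbhd_compl_def nbhd_def)

lemma infdist_almost_attained:
  assumes "A \<noteq> {}" "0 < e"
  obtains a where "a \<in> A" "dist x a < infdist x A + e"
proof -
  have "\<exists>a\<in>A. dist x a < infdist x A + e"
    using assms cInf_lessD[of "dist x ` A" "infdist x A + e"] by (auto simp: infdist_notempty)
  then show ?thesis using that by blast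
qed

text \<open>On a geodesic from \<open>a\<close> to \<open>x\<close> the distance to \<open>A\<close> at time \<open>s\<close> exceeds \<open>s - 1\<close>, as \<open>a\<close> is
  an almost nearest point of \<open>A\<close>. So the heavy zone ends by time \<open>M + 1\<close>, and the price \<open>\<Lambda>\<close> is
  not paid along a distance of order \<open>r\<close>. Two statements are needed because the cost of a chain
  depends on its direction.\<close>

lemma unit_chain_to_boundary:
  fixes A :: "'a::metric_space set"
  assumes geo: "geodesic_space TYPE('a)" and x: "infdist x A = r" and a: "a \<in> A" "dist x a < r + 1"
    and w: "\<And>z. w z \<le> \<Lambda>" "\<And>z. M \<le> infdist z A \<Longrightarrow> w z = 1" and M: "0 \<le> M" "M + 1 \<le> r"
  shows "\<exists>k. unit_chain w a x k \<and> real k \<le> real \<Lambda> * (M + 2) + r + 2"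
    and "\<exists>k. unit_chain w x a k \<and> real k \<le> real \<Lambda> * (M + 2) + r + 2"
proof -
  define d where "d = dist a x"
  have d: "r \<le> d" "d < r + 1"
    using infdist_le[OF a(1), of x] x a(2) by (auto simp: d_def dist_commute)
  obtain h where h: "h 0 = a" "h d = x" "1-lipschitz_on {0..d} h"
    "\<And>s. s \<in> {0..d} \<Longrightarrow> dist (h s) x = d - s"
    using geodesic_obtain[OF geo] unfolding d_def by metis
  have light: "w (h s) = 1" if "s \<in> {M + 1..d}" for s
  proof (rule w(2))
    have "infdist x A \<le> infdist (h s) A + dist x (h s)" by (rule infdist_triangle)
    then show "M \<le> infdist (h s) A"
      using that x d h(4)[of s] M by (auto simp: dist_commute)
  qed
  have lip: "1-lipschitz_on {0..M + 1} h" "1-lipschitz_on {M + 1..d} h"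
    using h(3) M d by (auto intro: lipschitz_on_subset)
  obtain k1 where k1: "unit_chain w (h 0) (h (M + 1)) k1" "real k1 \<le> real \<Lambda> * (M + 2)"
    using unit_chain_lipschitz[OF lip(1), of w \<Lambda>] w(1) M by (auto simp: add.commute)
  obtain k2 where k2: "unit_chain w (h (M + 1)) (h d) k2" "real k2 \<le> d - (M + 1) + 1"
    using unit_chain_lipschitz[OF lip(2), of w 1] light M d by auto
  show "\<exists>k. unit_chain w a x k \<and> real k \<le> real \<Lambda> * (M + 2) + r + 2"
    using unit_chain_trans[OF k2(1) k1(1)] k1(2) k2(2) h(1,2) d M
    by (intro exI[of _ "k1 + k2"]) auto
  obtain k3 where k3: "unit_chain w (h (M + 1)) (h 0) k3" "real k3 \<le> real \<Lambda> * (M + 2)"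
    using unit_chain_lipschitz[OF lipschitz_on_reverse[OF lip(1), of "M + 1"], of w \<Lambda>] w(1) M
    by (auto simp: add.commute)
  obtain k4 where k4: "unit_chain w (h d) (h (M + 1)) k4" "real k4 \<le> d - (M + 1) + 1"
    using unit_chain_lipschitz[OF lipschitz_on_reverse[OF lip(2), of d], of w 1] light M d
    by auto
  show "\<exists>k. unit_chain w x a k \<and> real k \<le> real \<Lambda> * (M + 2) + r + 2"
    using unit_chain_trans[OF k3(1) k4(1)] k3(2) k4(2) h(1,2) d M
    by (intro exI[of _ "k4 + k3"]) auto
qed

text \<open>The factor 3 keeps the projections of the two boundary points a distance
  \<open>3 * r - 2 * (r + 1)\<close> apart.\<close>

lemma Morse_imp_superlinear:
  fixes A :: "'a::metric_space set"
  assumes geo: "geodesic_space TYPE('a)" and A: "A \<noteq> {}" and morse: "Morse A"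
    and \<rho>: "0 < \<rho>"
  shows "completely_super_linear (lower_rel_div A \<rho> 3)"
  unfolding completely_super_linear_def
proof (intro allI impI)
  fix C :: real assume C: "0 < C"
  define \<Lambda> where "\<Lambda> = nat \<lceil>C + 4\<rceil>"
  have \<Lambda>: "C + 4 \<le> real \<Lambda>" unfolding \<Lambda>_def by linarith
  obtain M0 where M0: "\<And>a b c. a \<le> b \<Longrightarrow> quasi_geodesic \<Lambda> 2 {a..b} c \<Longrightarrow> c a \<in> A \<Longrightarrow> c b \<in> A
      \<Longrightarrow> c ` {a..b} \<subseteq> nbhd M0 A"
    using morse C \<Lambda> unfolding Morse_def by (metis add_increasing2 le_add_same_cancel2 less_eq_real_def
        numeral_One one_le_numeral order_trans zero_le_numeral)
  define M where "M = max 0 M0"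
  define R where "R = max (2 * real \<Lambda> * (M + 3) + 5) (max (M + 1) (M / \<rho>))"
  define w where "w z = (if infdist z A < M then \<Lambda> else 1)" for z
  have w: "1 \<le> w z" "w z \<le> \<Lambda>" "M \<le> infdist z A \<Longrightarrow> w z = 1" for z
    using \<Lambda> C by (auto simp: w_def)
  have "r \<le> R" if r: "0 \<le> r" "lower_rel_div A \<rho> 3 r \<le> ennreal (C * r)" for r
  proof (rule ccontr)
    assume "\<not> r \<le> R"
    then have big: "2 * real \<Lambda> * (M + 3) + 5 < r" "M + 1 < r" "M / \<rho> < r"
      by (auto simp: R_def)
    have M: "0 \<le> M" "0 < r" using big by (auto simp: M_def)
    have "lower_rel_div A \<rho> 3 r < ennreal ((C + 1) * r)"
      using r C M by (auto intro!: le_less_trans[OF r(2)] ennreal_lessI simp: algebra_simps)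
    then obtain x1 x2 where x: "infdist x1 A = r" "infdist x2 A = r" "3 * r \<le> dist x1 x2"
      and "length_dist (nbhd_compl (\<rho> * r) A) x1 x2 < ennreal ((C + 1) * r)"
      unfolding lower_rel_div_def Inf_less_iff by (auto simp: nbhd_boundary_def)
    then obtain g where g: "path g" "path_image g \<subseteq> nbhd_compl (\<rho> * r) A"
      "g 0 = x1" "g 1 = x2" "path_length g \<le> ennreal ((C + 1) * r)"
      unfolding length_dist_def Inf_less_iff pathstart_def pathfinish_def by force
    obtain a1 where a1: "a1 \<in> A" "dist x1 a1 < r + 1"
      using infdist_almost_attained[OF A, of 1 x1] x by auto
    obtain a2 where a2: "a2 \<in> A" "dist x2 a2 < r + 1"
      using infdist_almost_attained[OF A, of 1 x2] x by auto
    have far: "r - 2 \<le> dist a1 a2"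
      using x(3) a1(2) a2(2) dist_triangle[of x1 x2 a1] dist_triangle[of a1 x2 a2]
      by (simp add: dist_commute)
    obtain k1 where k1: "unit_chain w a1 x1 k1" "real k1 \<le> real \<Lambda> * (M + 2) + r + 2"
      using unit_chain_to_boundary(1)[OF geo x(1) a1, of w \<Lambda> M] w M big by auto
    obtain k3 where k3: "unit_chain w x2 a2 k3" "real k3 \<le> real \<Lambda> * (M + 2) + r + 2"
      using unit_chain_to_boundary(2)[OF geo x(2) a2, of w \<Lambda> M] w M big by auto
    have "w (g t) = 1" if "t \<in> {0..1}" for t
    proof (rule w(3))
      have "g t \<in> nbhd_compl (\<rho> * r) A" using g(2) that by (auto simp: path_image_def)
      then have "\<rho> * r \<le> infdist (g t) A" by (simp add: in_nbhd_compl_iff)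
      moreover have "M \<le> \<rho> * r" using big(3) \<rho> by (simp add: field_simps)
      ultimately show "M \<le> infdist (g t) A" by simp
    qed
    then obtain k2 where k2: "unit_chain w x1 x2 k2" "real k2 \<le> (C + 1) * r + 1"
      using unit_chain_path[OF g(1,5), of w] g(3,4) C M by auto
    \<comment> \<open>Out to the boundary, along the path, and back: a factor \<open>\<Lambda>\<close> occurs only near \<open>A\<close>.\<close>
    have competitor: "unit_chain w a1 a2 (k1 + k2 + k3)"
      using unit_chain_trans[OF k3(1) unit_chain_trans[OF k2(1) k1(1)]] .
    define k where "k = (LEAST k. unit_chain w a1 a2 k)"
    have k: "unit_chain w a1 a2 k" "k \<le> k1 + k2 + k3"
      unfolding k_def using competitor by (rule LeastI, rule Least_le)
    obtain y m where y: "y 0 = a1" "y m = a2" "\<And>p. p < m \<Longrightarrow> dist (y p) (y (Suc p)) \<le> 1"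
      "(\<Sum>p<m. w (y (Suc p))) = k"
      using sequence_of_unit_chain[OF k(1)] by metis
    have "quasi_geodesic \<Lambda> 2 {0..real m} (\<lambda>t. y (nat \<lfloor>t\<rfloor>))"
    proof (rule minimal_chain_quasi_geodesic[OF geo, of w])
      show "(\<Sum>p<m. w (y (Suc p))) \<le> l" if "unit_chain w (y 0) (y m) l" for l
        using that y(1,2,4) by (simp add: k_def Least_le)
    qed (use w y in auto)
    from M0[OF _ this] have near: "(\<lambda>t. y (nat \<lfloor>t\<rfloor>)) ` {0..real m} \<subseteq> nbhd M0 A"
      using y a1 a2 by simp
    have heavy: "w (y p) = \<Lambda>" if "p \<le> m" for p
    proof -
      have "y (nat \<lfloor>real p\<rfloor>) \<in> nbhd M0 A"
        using near that by (intro subsetD[OF near] image_eqI[of _ _ "real p"]) auto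
      then show ?thesis by (auto simp: nbhd_def w_def M_def)
    qed
    have "k = m * \<Lambda>"
      unfolding y(4)[symmetric] using heavy by simp
    moreover have "dist a1 a2 \<le> real m"
    proof -
      have "dist (y 0) (y j) \<le> real j" if "j \<le> m" for j
        using that
      proof (induction j)
        case (Suc j)
        then show ?case using y(3)[of j] dist_triangle[of "y 0" "y (Suc j)" "y j"] by auto
      qed simp
      from this[of m] show ?thesis using y by simp
    qed
    \<comment> \<open>As the chain stays in the heavy zone, every one of its steps costs \<open>\<Lambda>\<close>.\<close>
    ultimately have "real \<Lambda> * (r - 2) \<le> real k"
      using far by (simp add: mult.commute mult_left_mono)
    also have "\<dots> \<le> real k1 + real k2 + real k3" using k(2) by linarith
    also have "\<dots> \<le> (C + 3) * r + 2 * real \<Lambda> * (M + 2) + 5"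
      using k1(2) k2(2) k3(2) by (simp add: algebra_simps)
    finally have "(real \<Lambda> - (C + 3)) * r \<le> 2 * real \<Lambda> * (M + 3) + 5"
      by (simp add: algebra_simps)
    moreover have "1 * r \<le> (real \<Lambda> - (C + 3)) * r"
      using \<Lambda> M by (intro mult_right_mono) auto
    ultimately show False using big(1) by simp
  qed
  then show "bounded {r. 0 \<le> r \<and> lower_rel_div A \<rho> 3 r \<le> ennreal (C * r)}"
    by (intro boundedI[of _ R]) auto
qed

section \<open>Rectifiable paths outside a neighbourhood\<close>

text \<open>Rectifiable paths with an upper bound \<open>L\<close> on their length are represented by 1-Lipschitz
  maps on \<open>{0..L}\<close>; concatenating these adds the lengths without any subdivision of partitions.\<close>

definition lipschitz_joined :: "'a::metric_space set \<Rightarrow> real \<Rightarrow> 'a \<Rightarrow> 'a \<Rightarrow> bool" where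
  "lipschitz_joined S L x y \<longleftrightarrow> 0 \<le> L \<and>
     (\<exists>h. h 0 = x \<and> h L = y \<and> h ` {0..L} \<subseteq> S \<and> 1-lipschitz_on {0..L} h)"

lemma lipschitz_joined_sym:
  assumes "lipschitz_joined S L x y" shows "lipschitz_joined S L y x"
proof -
  obtain h where h: "0 \<le> L" "h 0 = x" "h L = y" "h ` {0..L} \<subseteq> S" "1-lipschitz_on {0..L} h"
    using assms unfolding lipschitz_joined_def by blast
  then show ?thesis
    using lipschitz_on_reverse[OF h(5), of L]
    unfolding lipschitz_joined_def by (intro conjI exI[of _ "\<lambda>t. h (L - t)"]) auto
qed

lemma lipschitz_joined_trans:
  assumes "lipschitz_joined S L1 x y" "lipschitz_joined S L2 y z"
  shows "lipschitz_joined S (L1 + L2) x z"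
proof -
  obtain h where h: "0 \<le> L1" "h 0 = x" "h L1 = y" "h ` {0..L1} \<subseteq> S" "1-lipschitz_on {0..L1} h"
    using assms unfolding lipschitz_joined_def by blast
  obtain k where k: "0 \<le> L2" "k 0 = y" "k L2 = z" "k ` {0..L2} \<subseteq> S" "1-lipschitz_on {0..L2} k"
    using assms unfolding lipschitz_joined_def by blast
  define j where "j t = (if t \<le> L1 then h t else k (t - L1))" for t
  have "1-lipschitz_on {L1..L1 + L2} (\<lambda>t. k (t - L1))"
  proof (rule lipschitz_onI)
    fix s t assume "s \<in> {L1..L1 + L2}" "t \<in> {L1..L1 + L2}"
    then show "dist (k (s - L1)) (k (t - L1)) \<le> 1 * dist s t"
      using lipschitz_onD[OF k(5), of "s - L1" "t - L1"] by (auto simp: dist_real_def)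
  qed simp
  then have "1-lipschitz_on {0..L1 + L2} j"
    unfolding j_def by (intro lipschitz_on_concat h) (use h k in auto)
  moreover have "j ` {0..L1 + L2} \<subseteq> S"
  proof
    fix u assume "u \<in> j ` {0..L1 + L2}"
    then obtain t where t: "0 \<le> t" "t \<le> L1 + L2" "u = j t" by auto
    show "u \<in> S"
    proof (cases "t \<le> L1")
      case True
      then show ?thesis using t h(4) by (auto simp: j_def)
    next
      case False
      then have "t - L1 \<in> {0..L2}" using t by auto
      then show ?thesis using t k(4) False by (auto simp: j_def)
    qed
  qed
  moreover have "j 0 = x" "j (L1 + L2) = z" using h k by (auto simp: j_def)
  ultimately show ?thesis
    unfolding lipschitz_joined_def using h(1) k(1) by (intro conjI exI[of _ j]) auto
qed

lemma path_length_lipschitz: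
  assumes "L-lipschitz_on {0..1} g"
  shows "path_length g \<le> ennreal L"
  unfolding path_length_def
proof (rule SUP_least)
  fix ts :: "real list" assume "ts \<in> {ts. sorted ts \<and> set ts \<subseteq> {0..1}}"
  then have ts: "sorted ts" "set ts \<subseteq> {0..1}" by auto
  have L: "0 \<le> L" using assms by (rule lipschitz_on_nonneg)
  define n where "n = length ts - 1"
  have mem: "ts ! i \<in> {0..1}" if "i \<le> n" "ts \<noteq> []" for i
  proof -
    have "ts ! i \<in> set ts" using that by (intro nth_mem) (cases ts, auto simp: n_def)
    then show ?thesis using ts(2) by blast
  qed
  have "(\<Sum>i<n. dist (g (ts ! i)) (g (ts ! Suc i))) \<le> (\<Sum>i<n. L * ts ! Suc i - L * ts ! i)"
  proof (rule sum_mono)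
    fix i assume "i \<in> {..<n}"
    then have i: "Suc i < length ts" by (auto simp: n_def)
    then have "ts ! i \<le> ts ! Suc i" using ts(1) by (simp add: sorted_nth_mono)
    moreover have "dist (g (ts ! i)) (g (ts ! Suc i)) \<le> L * dist (ts ! i) (ts ! Suc i)"
      using i by (intro lipschitz_onD[OF assms] mem) (auto simp: n_def)
    ultimately show "dist (g (ts ! i)) (g (ts ! Suc i)) \<le> L * ts ! Suc i - L * ts ! i"
      by (simp add: dist_real_def algebra_simps)
  qed
  also have "\<dots> = L * (ts ! n - ts ! 0)"
    using sum_lessThan_telescope[of "\<lambda>i. L * ts ! i" n] by (simp add: algebra_simps)
  also have "\<dots> \<le> L"
  proof (cases "ts = []")
    case True
    then show ?thesis using L by (simp add: n_def)
  next
    case False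
    have "L * (ts ! n - ts ! 0) \<le> L * 1"
      using mem[OF _ False, of n] mem[OF _ False, of 0] L by (intro mult_left_mono) auto
    then show ?thesis by simp
  qed
  finally show "(\<Sum>i<length ts - 1. ennreal (dist (g (ts ! i)) (g (ts ! Suc i)))) \<le> ennreal L"
    by (simp add: n_def sum_ennreal ennreal_leI)
qed

lemma length_dist_le_of_lipschitz_joined:
  assumes "lipschitz_joined S L x y"
  shows "length_dist S x y \<le> ennreal L"
proof -
  obtain h where h: "0 \<le> L" "h 0 = x" "h L = y" "h ` {0..L} \<subseteq> S" "1-lipschitz_on {0..L} h"
    using assms unfolding lipschitz_joined_def by blast
  define g where "g t = h (L * t)" for t
  have in': "L * t \<in> {0..L}" if "t \<in> {0..1}" for t
    using that h(1) mult_left_mono[of t 1 L] by auto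
  have lip: "L-lipschitz_on {0..1} g"
  proof (rule lipschitz_onI)
    fix s t :: real assume "s \<in> {0..1}" "t \<in> {0..1}"
    then have "dist (g s) (g t) \<le> 1 * dist (L * s) (L * t)"
      unfolding g_def by (intro lipschitz_onD[OF h(5)] in')
    also have "\<dots> = L * dist s t"
      using h(1) by (simp add: dist_real_def abs_mult flip: right_diff_distrib)
    finally show "dist (g s) (g t) \<le> L * dist s t" .
  qed (rule h(1))
  have "path g" unfolding path_def using lip by (rule lipschitz_on_continuous_on)
  moreover have "path_image g \<subseteq> S" using in' h(4) by (auto simp: path_image_def g_def)
  moreover have "pathstart g = x" "pathfinish g = y"
    using h by (auto simp: g_def pathstart_def pathfinish_def)
  ultimately have "length_dist S x y \<le> path_length g"
    unfolding length_dist_def by (intro Inf_lower) auto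
  also have "\<dots> \<le> ennreal L" by (rule path_length_lipschitz[OF lip])
  finally show ?thesis .
qed

text \<open>Walk along a geodesic towards an almost nearest point of \<open>A\<close> and stop at the first
  time when the distance to \<open>A\<close> is at most \<open>r\<close>. By minimality of this time, the walk has not
  entered \<open>nbhd r A\<close>.\<close>

lemma descend_to_boundary:
  fixes A :: "'a::metric_space set"
  assumes geo: "geodesic_space TYPE('a)" and A: "A \<noteq> {}" and r: "0 \<le> r" "r \<le> infdist y A"
  obtains x L where "infdist x A = r" "dist y x \<le> infdist y A + 1" "L \<le> infdist y A + 1"
    "lipschitz_joined (nbhd_compl r A) L y x"
proof -
  obtain a where a: "a \<in> A" "dist y a < infdist y A + 1"
    using infdist_almost_attained[OF A, of 1 y] by auto
  define d where "d = dist y a"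
  obtain h where h: "h 0 = y" "h d = a" "1-lipschitz_on {0..d} h"
    "\<And>s. s \<in> {0..d} \<Longrightarrow> dist y (h s) = s"
    using geodesic_obtain[OF geo] unfolding d_def by metis
  define \<phi> where "\<phi> s = infdist (h s) A" for s
  have cont: "continuous_on {0..d} \<phi>"
    unfolding \<phi>_def using lipschitz_on_continuous_on[OF h(3)] by (intro continuous_intros)
  define Z where "Z = {s \<in> {0..d}. \<phi> s \<le> r}"
  have "closed Z"
    unfolding Z_def by (intro continuous_closed_preimage_constant
        continuous_on_closed_Collect_le cont continuous_intros closed_atLeastAtMost)
  then have "compact Z"
    by (auto simp: compact_eq_bounded_closed Z_def intro: bounded_subset[OF bounded_closed_interval])
  moreover have "d \<in> Z" using h(2) a(1) r by (auto simp: Z_def \<phi>_def d_def)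
  ultimately obtain s where s: "s \<in> Z" and min: "\<And>t. t \<in> Z \<Longrightarrow> s \<le> t"
    using compact_attains_inf[of Z] by auto
  have sd: "0 \<le> s" "s \<le> d" "\<phi> s \<le> r" using s by (auto simp: Z_def)
  have "continuous_on {0..s} \<phi>" using cont sd by (auto intro: continuous_on_subset)
  then obtain t where t: "0 \<le> t" "t \<le> s" "\<phi> t = r"
    using IVT2'[of \<phi> s r 0] sd r h(1) by (auto simp: \<phi>_def)
  then have "s \<le> t" using sd by (intro min) (auto simp: Z_def)
  then have \<phi>s: "\<phi> s = r" using t by simp
  have out: "r \<le> \<phi> u" if "u \<in> {0..s}" for u
  proof (cases "u = s")
    case False
    then have "u \<notin> Z" using min[of u] that by auto
    then show ?thesis using that sd by (auto simp: Z_def)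
  qed (use \<phi>s in simp)
  have "lipschitz_joined (nbhd_compl r A) s y (h s)"
    unfolding lipschitz_joined_def
  proof (intro conjI exI[of _ h])
    show "h ` {0..s} \<subseteq> nbhd_compl r A"
      using out by (auto simp: in_nbhd_compl_iff \<phi>_def)
    show "1-lipschitz_on {0..s} h" using h(3) sd by (auto intro: lipschitz_on_subset)
  qed (use h sd in auto)
  then show ?thesis
    using that[of "h s" s] \<phi>s h(4)[of s] sd a(2) by (auto simp: \<phi>_def d_def)
qed

text \<open>A quasi-geodesic may be discontinuous, so it is sampled at integer steps and interpolated by
  geodesics. The margin \<open>E\<close> in the height of the samples keeps these geodesics outside
  \<open>nbhd r A\<close>.\<close>

lemma lipschitz_joined_samples:
  fixes x :: "nat \<Rightarrow> 'a::metric_space"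
  assumes geo: "geodesic_space TYPE('a)"
    and step: "\<And>i. i < m \<Longrightarrow> dist (x i) (x (Suc i)) \<le> E"
    and far: "\<And>i. i \<le> m \<Longrightarrow> r + E \<le> infdist (x i) A" and "0 \<le> E"
  shows "\<exists>L. L \<le> E * real m \<and> lipschitz_joined (nbhd_compl r A) L (x 0) (x m)"
  using step far
proof (induction m)
  case 0
  then have "lipschitz_joined (nbhd_compl r A) 0 (x 0) (x 0)"
    using \<open>0 \<le> E\<close> 0(2)[of 0] unfolding lipschitz_joined_def
    by (intro conjI exI[of _ "\<lambda>_. x 0"])
       (auto simp: in_nbhd_compl_iff lipschitz_on_def)
  then show ?case by (intro exI[of _ 0]) simp
next
  case (Suc m)
  have "\<exists>L. L \<le> E * real m \<and> lipschitz_joined (nbhd_compl r A) L (x 0) (x m)"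
    by (rule Suc.IH) (use Suc.prems in auto)
  then obtain L where L: "L \<le> E * real m" "lipschitz_joined (nbhd_compl r A) L (x 0) (x m)"
    by blast
  define d where "d = dist (x m) (x (Suc m))"
  have d: "d \<le> E" using Suc.prems(1)[of m] by (simp add: d_def)
  obtain h where h: "h 0 = x m" "h d = x (Suc m)" "1-lipschitz_on {0..d} h"
    "\<And>s. s \<in> {0..d} \<Longrightarrow> dist (x m) (h s) = s"
    using geodesic_obtain[OF geo] unfolding d_def by metis
  have "r \<le> infdist (h s) A" if "s \<in> {0..d}" for s
    using infdist_triangle[of "x m" A "h s"] h(4)[OF that] Suc.prems(2)[of m] d that by auto
  then have "lipschitz_joined (nbhd_compl r A) d (x m) (x (Suc m))"
    unfolding lipschitz_joined_def
    by (intro conjI exI[of _ h]) (use h in \<open>auto simp: in_nbhd_compl_iff d_def\<close>)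
  from lipschitz_joined_trans[OF L(2) this] show ?case
    using L(1) d by (intro exI[of _ "L + d"]) (auto simp: algebra_simps)
qed

section \<open>Completely super linear divergence implies Morse\<close>

text \<open>The two descents from the ends of the excursion have length at most \<open>B * r + 1\<close> each. The
  excursion has to be long enough that its ends are \<open>n * r + 2 * (B * r + 1)\<close> apart, so that the
  points reached on the boundary are still \<open>n * r\<close> apart.\<close>

lemma lower_rel_div_le_of_excursion:
  fixes A :: "'a::metric_space set"
  assumes geo: "geodesic_space TYPE('a)" and A: "A \<noteq> {}"
    and KC: "1 \<le> K" "0 \<le> C" and qg: "quasi_geodesic K C {a..b} c"
    and sm: "a \<le> s" "s + real m \<le> b" and r: "1 + K + C \<le> r"
    and far: "\<And>i. i \<le> m \<Longrightarrow> 2 * r \<le> infdist (c (s + real i)) A"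
    and ends: "infdist (c s) A \<le> B * r" "infdist (c (s + real m)) A \<le> B * r"
    and long: "K * (real n + 2 * B + 3) * r \<le> real m"
  shows "lower_rel_div A 1 n r \<le> ennreal ((K + C) * real m + 2 * (B * r + 1))"
proof -
  define y1 y2 where y_def: "y1 = c s" "y2 = c (s + real m)"
  have step: "dist (c (s + real i)) (c (s + real (Suc i))) \<le> K + C" if "i < m" for i
  proof -
    have "s + real i \<in> {a..b}" "s + real (Suc i) \<in> {a..b}" using sm that by auto
    then show ?thesis using qg unfolding quasi_geodesic_def by fastforce
  qed
  obtain L where L: "L \<le> (K + C) * real m" "lipschitz_joined (nbhd_compl r A) L y1 y2"
    using lipschitz_joined_samples[OF geo, of m "\<lambda>i. c (s + real i)" "K + C" r A] step far r KC
    unfolding y_def by force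
  have f: "r \<le> infdist y1 A" "r \<le> infdist y2 A"
    using far[of 0] far[of m] r KC by (auto simp: y_def)
  obtain x1 L1 where x1: "infdist x1 A = r" "dist y1 x1 \<le> infdist y1 A + 1" "L1 \<le> infdist y1 A + 1"
    "lipschitz_joined (nbhd_compl r A) L1 y1 x1"
    using descend_to_boundary[OF geo A _ f(1)] r KC by (metis add_nonneg_nonneg order_trans zero_le_one)
  obtain x2 L2 where x2: "infdist x2 A = r" "dist y2 x2 \<le> infdist y2 A + 1" "L2 \<le> infdist y2 A + 1"
    "lipschitz_joined (nbhd_compl r A) L2 y2 x2"
    using descend_to_boundary[OF geo A _ f(2)] r KC by (metis add_nonneg_nonneg order_trans zero_le_one)
  have "lipschitz_joined (nbhd_compl r A) (L1 + L + L2) x1 x2"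
    by (intro lipschitz_joined_trans[OF lipschitz_joined_trans[OF lipschitz_joined_sym[OF x1(4)] L(2)] x2(4)])
  then have "length_dist (nbhd_compl r A) x1 x2 \<le> ennreal (L1 + L + L2)"
    by (rule length_dist_le_of_lipschitz_joined)
  also have "\<dots> \<le> ennreal ((K + C) * real m + 2 * (B * r + 1))"
    using L(1) x1(3) x2(3) ends by (intro ennreal_leI) (auto simp: y_def)
  finally have len: "length_dist (nbhd_compl r A) x1 x2 \<le> ennreal ((K + C) * real m + 2 * (B * r + 1))" .
  have "1 / K * real m - C \<le> dist y1 y2"
  proof -
    have "s \<in> {a..b}" "s + real m \<in> {a..b}" using sm by auto
    then have "1 / K * \<bar>s - (s + real m)\<bar> - C \<le> dist (c s) (c (s + real m))"
      using qg unfolding quasi_geodesic_def by blast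
    then show ?thesis by (simp add: y_def)
  qed
  moreover have "(real n + 2 * B + 3) * r \<le> 1 / K * real m"
    using long KC by (simp add: field_simps)
  moreover have "dist y1 y2 \<le> dist y1 x1 + dist x1 x2 + dist y2 x2"
    using dist_triangle[of y1 y2 x1] dist_triangle[of x1 y2 x2] by (simp add: dist_commute)
  ultimately have "real n * r \<le> dist x1 x2"
    using x1(2) x2(2) ends r KC by (simp add: y_def algebra_simps)
  then have "lower_rel_div A 1 n r \<le> length_dist (nbhd_compl (1 * r) A) x1 x2"
    unfolding lower_rel_div_def using x1(1) x2(1) le_less_trans[OF len ennreal_less_top]
    by (intro Inf_lower CollectI exI[of _ x1] exI[of _ x2]) (auto simp: nbhd_boundary_def)
  also have "\<dots> \<le> ennreal ((K + C) * real m + 2 * (B * r + 1))" using len by simp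
  finally show ?thesis .
qed

text \<open>The last sample before the height first falls below \<open>2 * r\<close>. It exists because the height
  changes by at most \<open>r\<close> per unit of time and is 0 at both ends of \<open>{a..b}\<close>. The sign \<open>e\<close> selects
  the direction of travel.\<close>

lemma excursion_one_side:
  fixes A :: "'a::metric_space set" and e :: real
  assumes KC: "1 \<le> K" "0 \<le> C" and qg: "quasi_geodesic K C {a..b} c"
    and A: "c a \<in> A" "c b \<in> A" and t: "t \<in> {a..b}" and e: "e = 1 \<or> e = -1"
    and r: "1 + K + C \<le> r" and top: "2 * r \<le> infdist (c t) A"
  obtains i where "t + e * real i \<in> {a..b}" "\<And>j. j \<le> i \<Longrightarrow> 2 * r \<le> infdist (c (t + e * real j)) A"
    "infdist (c (t + e * real i)) A \<le> 3 * r"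
proof -
  define q where "q j = infdist (c (t + e * real j)) A" for j
  define Q where "Q j \<longleftrightarrow> t + e * real j \<notin> {a..b} \<or> q j < 2 * r" for j
  have step: "infdist (c u) A \<le> infdist (c v) A + r" if "u \<in> {a..b}" "v \<in> {a..b}" "\<bar>u - v\<bar> \<le> 1" for u v
  proof -
    have "dist (c u) (c v) \<le> K * \<bar>u - v\<bar> + C" using qg that unfolding quasi_geodesic_def by blast
    also have "\<dots> \<le> K * 1 + C" using KC that by (intro add_right_mono mult_left_mono) auto
    finally show ?thesis using infdist_triangle[of "c u" A "c v"] r by simp
  qed
  have "\<exists>j. Q j"
  proof -
    have "t + e * real (nat \<lceil>b - a + 1\<rceil>) \<notin> {a..b}"
    proof -
      have "b - a + 1 \<le> real (nat \<lceil>b - a + 1\<rceil>)" by linarith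
      then have "b < t + real (nat \<lceil>b - a + 1\<rceil>)" "t - real (nat \<lceil>b - a + 1\<rceil>) < a"
        using t unfolding atLeastAtMost_iff by linarith+
      then show ?thesis using e by (elim disjE) (simp_all del: of_nat_nat)
    qed
    then show ?thesis unfolding Q_def by blast
  qed
  then obtain n where n: "Q n" "\<And>j. j < n \<Longrightarrow> \<not> Q j"
    using LeastI_ex[of Q] not_less_Least[of _ Q] by blast
  have "\<not> Q 0" using t top by (simp add: Q_def q_def)
  then obtain i where i: "n = Suc i" using n(1) by (cases n) auto
  have before: "t + e * real j \<in> {a..b}" "2 * r \<le> q j" if "j \<le> i" for j
    using n(2)[of j] that i by (auto simp: Q_def not_less)
  have "t + e * real (Suc i) \<in> {a..b}"
  proof (rule ccontr)
    assume out: "\<not> ?thesis"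
    \<comment> \<open>Leaving the interval at the next step would mean that an endpoint in \<open>A\<close> is within time 1.\<close>
    define z where "z = (if e = 1 then b else a)"
    have z: "z \<in> {a..b}" "c z \<in> A" "\<bar>t + e * real i - z\<bar> \<le> 1"
      using out before(1)[of i] t e A by (auto simp: z_def)
    then have "q i \<le> r"
      using step[OF before(1)[of i] z(1) z(3)] by (simp add: q_def)
    then show False using before(2)[of i] r KC by simp
  qed
  moreover from this have "q (Suc i) < 2 * r" using n(1) i by (simp add: Q_def)
  moreover have "\<bar>(t + e * real i) - (t + e * real (Suc i))\<bar> \<le> 1" using e by auto
  ultimately have "q i \<le> 3 * r"
    using step[OF before(1)[of i], of "t + e * real (Suc i)"] by (simp add: q_def)
  then show ?thesis using that[of i] before by (auto simp: q_def)
qed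

lemma superlinear_imp_Morse:
  fixes A :: "'a::metric_space set"
  assumes geo: "geodesic_space TYPE('a)" and A: "A \<noteq> {}"
    and super: "completely_super_linear (lower_rel_div A 1 n)"
  shows "Morse A"
  unfolding Morse_def
proof (intro allI impI)
  fix K C :: real assume KC: "1 \<le> K" "0 \<le> C"
  \<comment> \<open>\<open>N\<close> makes a complete excursion, with ends of height at most \<open>3 * r\<close>, long enough for
    \<open>lower_rel_div_le_of_excursion\<close> with \<open>B = 3\<close>; \<open>\<kappa> * r\<close> is the duration required there with
    \<open>B = 2 * N\<close>, for a piece cut off at an arbitrary height.\<close>
  define N where "N = 4 + K^2 * (real n + 9)"
  define \<kappa> where "\<kappa> = K * (real n + 2 * (2 * N) + 3)"
  define C0 where "C0 = (K + C) * (2 * (\<kappa> + 1)) + 2 * (2 * N + 1)"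
  have N: "4 \<le> N" using KC by (simp add: N_def)
  have \<kappa>: "0 < \<kappa>" using KC N by (auto simp: \<kappa>_def intro!: mult_pos_pos add_nonneg_pos)
  have C0: "0 < C0" using KC N \<kappa> by (auto simp: C0_def intro!: add_nonneg_pos)
  have "bounded {r. 0 \<le> r \<and> lower_rel_div A 1 n r \<le> ennreal (C0 * r)}"
    using super C0 unfolding completely_super_linear_def by blast
  then obtain R where R: "\<And>r. 0 \<le> r \<Longrightarrow> lower_rel_div A 1 n r \<le> ennreal (C0 * r) \<Longrightarrow> r \<le> R"
    unfolding bounded_iff by fastforce
  define M where "M = 2 * N * (\<bar>R\<bar> + K + C + 1)"
  show "\<exists>M. \<forall>a b c. a \<le> b \<and> quasi_geodesic K C {a..b} c \<and> c a \<in> A \<and> c b \<in> A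
        \<longrightarrow> c ` {a..b} \<subseteq> nbhd M A"
  proof (intro exI[of _ M] allI impI, elim conjE, rule ccontr)
    fix a b and c :: "real \<Rightarrow> 'a"
    assume ab: "a \<le> b" and qg: "quasi_geodesic K C {a..b} c" and cA: "c a \<in> A" "c b \<in> A"
      and "\<not> c ` {a..b} \<subseteq> nbhd M A"
    define f where "f t = infdist (c t) A" for t
    from \<open>\<not> c ` {a..b} \<subseteq> nbhd M A\<close> obtain t' where t': "t' \<in> {a..b}" "M \<le> f t'"
      by (force simp: nbhd_def f_def not_less)
    have dist_le: "dist (c u) (c v) \<le> K * \<bar>u - v\<bar> + C" if "u \<in> {a..b}" "v \<in> {a..b}" for u v
      using qg that unfolding quasi_geodesic_def by blast
    have "f t \<le> K * (b - a) + C" if "t \<in> {a..b}" for t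
    proof -
      have "f t \<le> dist (c t) (c a)" unfolding f_def by (rule infdist_le[OF cA(1)])
      also have "\<dots> \<le> K * \<bar>t - a\<bar> + C" using that ab by (intro dist_le) auto
      also have "\<dots> \<le> K * (b - a) + C" using that KC by (intro add_right_mono mult_left_mono) auto
      finally show ?thesis .
    qed
    then have bdd: "bdd_above (f ` {a..b})" by (intro bdd_aboveI2[of _ _ "K * (b - a) + C"])
    define D where "D = (SUP t\<in>{a..b}. f t)"
    have D: "f t \<le> D" if "t \<in> {a..b}" for t
      unfolding D_def using bdd that by (rule cSUP_upper2) simp
    have Mpos: "0 < M" using N KC by (auto simp: M_def intro!: mult_pos_pos)
    then have "D / 2 < D" using D[OF t'(1)] t'(2) by simp
    then have "\<exists>t\<in>{a..b}. D / 2 < f t"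
      using less_cSUP_iff[of "{a..b}" f "D / 2"] bdd ab unfolding D_def[symmetric] by simp
    then obtain t where t: "t \<in> {a..b}" "D / 2 < f t" by blast
    define r where "r = f t / N"
    have ft: "f t = N * r" using N by (simp add: r_def)
    have "2 * N * (\<bar>R\<bar> + K + C + 1) < 2 * N * r"
      using D[OF t'(1)] t' t unfolding M_def ft by linarith
    then have r: "\<bar>R\<bar> + K + C + 1 < r" using N by simp
    then have r1: "1 + K + C \<le> r" and "0 < r" using KC by auto
    have max: "f u \<le> 2 * N * r" if "u \<in> {a..b}" for u
      using D[OF that] t(2) ft by linarith
    have top: "2 * r \<le> infdist (c t) A"
      using ft N \<open>0 < r\<close> mult_right_mono[of 2 N r] by (simp add: f_def)
    obtain i where i: "t + real i \<in> {a..b}" "\<And>j. j \<le> i \<Longrightarrow> 2 * r \<le> f (t + real j)" "f (t + real i) \<le> 3 * r"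
      using excursion_one_side[OF KC qg cA t(1) _ r1 top, of 1] unfolding f_def by auto
    obtain l where l: "t - real l \<in> {a..b}" "\<And>j. j \<le> l \<Longrightarrow> 2 * r \<le> f (t - real j)" "f (t - real l) \<le> 3 * r"
      using excursion_one_side[OF KC qg cA t(1) _ r1 top, of "-1"] unfolding f_def by auto
    \<comment> \<open>Both cases below yield an excursion that satisfies the following bounds.\<close>
    have contra: False
      if "lower_rel_div A 1 n r \<le> ennreal ((K + C) * real m + 2 * (B * r + 1))"
        "real m \<le> 2 * (\<kappa> + 1) * r" "B \<le> 2 * N" for m B
    proof -
      have 1: "(K + C) * real m \<le> (K + C) * (2 * (\<kappa> + 1) * r)"
        using that KC by (intro mult_left_mono) auto
      have 2: "B * r \<le> 2 * N * r" using that \<open>0 < r\<close> by (intro mult_right_mono) auto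
      have "(K + C) * real m + 2 * (B * r + 1) \<le> C0 * r"
      proof -
        have C0r: "C0 * r = (K + C) * (2 * (\<kappa> + 1) * r) + 2 * (2 * N * r + r)"
          by (simp add: C0_def algebra_simps)
        have "1 \<le> r" using r1 KC by simp
        with 2 have "B * r + 1 \<le> 2 * N * r + r" by (rule add_mono)
        then have "2 * (B * r + 1) \<le> 2 * (2 * N * r + r)" by (rule mult_left_mono) simp
        from add_mono[OF 1 this] show ?thesis unfolding C0r .
      qed
      then have "lower_rel_div A 1 n r \<le> ennreal (C0 * r)"
        using that(1) ennreal_leI order_trans by blast
      then have "r \<le> R" using R \<open>0 < r\<close> by simp
      then show False using r KC by simp
    qed
    define m where "m = nat \<lceil>\<kappa> * r\<rceil>"
    have m: "\<kappa> * r \<le> real m" "real m \<le> (\<kappa> + 1) * r"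
    proof -
      have "0 \<le> \<kappa> * r" "1 \<le> r" using \<kappa> \<open>0 < r\<close> r1 KC by auto
      then show "\<kappa> * r \<le> real m" "real m \<le> (\<kappa> + 1) * r"
        unfolding m_def distrib_right mult_1 by linarith+
    qed
    have "0 \<le> (\<kappa> + 1) * r" and double: "2 * (\<kappa> + 1) * r = (\<kappa> + 1) * r + (\<kappa> + 1) * r"
      using \<kappa> \<open>0 < r\<close> by simp_all
    with m have m2: "real m \<le> 2 * (\<kappa> + 1) * r" by linarith
    show False
    proof (cases "m \<le> i \<or> m \<le> l")
      case True
      obtain s where s: "a \<le> s" "s + real m \<le> b" "\<And>j. j \<le> m \<Longrightarrow> 2 * r \<le> f (s + real j)"
      proof (cases "m \<le> i")
        case True
        then show ?thesis using that[of t] i t by auto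
      next
        case False
        with True have "m \<le> l" by simp
        have "2 * r \<le> f (t - real m + real j)" if "j \<le> m" for j
          using l(2)[of "m - j"] that \<open>m \<le> l\<close> by (simp add: of_nat_diff algebra_simps)
        then show ?thesis using that[of "t - real m"] l(1) t(1) \<open>m \<le> l\<close> by auto
      qed
      have "lower_rel_div A 1 n r \<le> ennreal ((K + C) * real m + 2 * (2 * N * r + 1))"
        using s max[of s] max[of "s + real m"] m(1)
        by (intro lower_rel_div_le_of_excursion[OF geo A KC qg s(1,2) r1])
           (auto simp: f_def \<kappa>_def)
      then show False
        by (rule contra[OF _ m2 order_refl])
    next
      case False
      define s where "s = t - real l"
      have end': "s + real (l + i) = t + real i" by (simp add: s_def)
      have far: "2 * r \<le> f (s + real j)" if "j \<le> l + i" for j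
      proof (cases "j \<le> l")
        case True
        then show ?thesis using l(2)[of "l - j"] by (simp add: s_def of_nat_diff algebra_simps)
      next
        case False
        then show ?thesis using i(2)[of "j - l"] that by (simp add: s_def of_nat_diff algebra_simps)
      qed
      \<comment> \<open>Descending from height \<open>N * r\<close> to \<open>3 * r\<close> takes time, so already the right half is long.\<close>
      have "N * r \<le> 3 * r + K * real i + C"
        using infdist_triangle[of "c t" A "c (t + real i)"] i(3) dist_le[OF t(1) i(1)] ft
        by (simp add: f_def)
      then have "(N - 4) * r \<le> K * real i" using r1 KC by (simp add: algebra_simps)
      then have "K * (K * (real n + 2 * 3 + 3) * r) \<le> K * real i"
        by (simp add: N_def power2_eq_square algebra_simps)
      then have "K * (real n + 2 * 3 + 3) * r \<le> real i" using KC by simp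
      then have long: "K * (real n + 2 * 3 + 3) * r \<le> real (l + i)" by simp
      have "lower_rel_div A 1 n r \<le> ennreal ((K + C) * real (l + i) + 2 * (3 * r + 1))"
        using far l(1,3) i(1,3) end' long
        by (intro lower_rel_div_le_of_excursion[OF geo A KC qg, of s] r1)
           (auto simp: f_def s_def)
      then show False
      proof (rule contra)
        show "real (l + i) \<le> 2 * (\<kappa> + 1) * r"
          unfolding double using False add_mono[OF m(2) m(2)] by linarith
      qed (use N in simp)
    qed
  qed
qed

theorem theorem1p6:
  fixes A :: "'a::metric_space set"
  assumes "geodesic_space TYPE('a)"
    and "\<not> bounded A"
  shows "Morse A \<longleftrightarrow> completely_super_linear_family (lower_rel_div A)"
proof
  have A: "A \<noteq> {}" using assms(2) by auto
  show "completely_super_linear_family (lower_rel_div A)" if "Morse A"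
    unfolding completely_super_linear_family_def
    using Morse_imp_superlinear[OF assms(1) A that] by (intro exI[of _ 3]) simp
  show "Morse A" if "completely_super_linear_family (lower_rel_div A)"
    using that superlinear_imp_Morse[OF assms(1) A]
    unfolding completely_super_linear_family_def by (metis less_eq_real_def zero_less_one)
qed

end
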